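(* Let $N\ge 3$ be an integer, $\alpha=\pi/N$, and $d\in\mathbb{R}$ with $|d|<1$. For $t\in\mathbb{R}$ let $w_1,\dots,w_N$ be the vertices of the harmonic $N$-gon $P=P(d,t)$ constructed in the context, and let $s_k=|w_k-w_{k-1}|$ ($k=1,\dots,N$, indices modulo $N$) be its sidelengths. Then the sum of inverse squared sidelengths does not depend on $t$, and $$\sum_{k=1}^N \frac{1}{s_k^2}= N\,\frac{ d^2 \cos^2\alpha+(d^{4}+1)/4 }{ (1-d^2)^2 \sin^2\alpha}.$$
   Context: Identify $\mathbb{R}^2$ with $\mathbb{C}$. Let $C$ be the unit circle centered at $0$. For $t\in\mathbb{R}$ put $z_k=e^{i(2\alpha k+t)}$, $k=1,\dots,N$ (indices modulo $N$); these are the vertices of a regular $N$-gon inscribed in $C$. For each $k$ let $w_k$ be the second intersection with $C$ of the line through $d$ and $z_k$, i.e. $w_k=\dfrac{d\bar z_k-1}{\bar z_k-d}$. The polygon $P$ with consecutive vertices $w_1,\dots,w_N$ is the harmonic polygon associated with $d$ and $t$; for fixed $N,d$ the harmonic family is obtained by varying $t$. *)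

theory Defs
  imports "HOL-Analysis.Analysis"
begin

text \<open>The index \<open>k\<close> ranges over all integers; indices modulo \<open>N\<close> are accounted for by the
  periodicity lemma \<open>base_vertex_periodic\<close> below.\<close>

definition base_vertex :: "nat \<Rightarrow> real \<Rightarrow> int \<Rightarrow> complex" where
  "base_vertex N t k = cis (2 * (pi / real N) * of_int k + t)"

definition second_intersection :: "real \<Rightarrow> complex \<Rightarrow> complex" where
  "second_intersection d z = (of_real d * cnj z - 1) / (cnj z - of_real d)"

definition harmonic_vertex :: "nat \<Rightarrow> real \<Rightarrow> real \<Rightarrow> int \<Rightarrow> complex" where
  "harmonic_vertex N d t k = second_intersection d (base_vertex N t k)"

definition harmonic_side :: "nat \<Rightarrow> real \<Rightarrow> real \<Rightarrow> int \<Rightarrow> real" where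
  "harmonic_side N d t k = dist (harmonic_vertex N d t k) (harmonic_vertex N d t (k - 1))"

lemma base_vertex_periodic:
  assumes "N > 0"
  shows "base_vertex N t (k + int N) = base_vertex N t k"
proof -
  have "2 * (pi / real N) * of_int (k + int N) + t = (2 * (pi / real N) * of_int k + t) + 2 * pi"
    using assms by (simp add: field_simps)
  then show ?thesis
    unfolding base_vertex_def by (simp add: cis_mult [symmetric])
qed

text \<open>The formula for \<open>second_intersection\<close> does give the intersection point other than \<open>z\<close> of
  the unit circle with the line through \<open>d\<close> and \<open>z\<close>.\<close>

lemma second_intersection_line:
  assumes d: "\<bar>d\<bar> < 1" and z: "norm z = 1"
  shows "sphere 0 1 \<inter> affine hull {of_real d, z} = {z, second_intersection d z}"
    and "second_intersection d z \<noteq> z"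
proof -
  define q where "q = (norm (z - of_real d))\<^sup>2"
  define v where "v = (d\<^sup>2 - 1) / q"
  have ne: "z \<noteq> of_real d" using d z by auto
  have q: "q > 0" using ne by (simp add: q_def)
  have d2: "d\<^sup>2 < 1" using d by (simp add: abs_square_less_1)
  have v: "v < 0" using q d2 by (simp add: v_def divide_neg_pos)
  have ne': "cnj z - of_real d \<noteq> 0"
    using ne by (metis complex_cnj_cnj complex_cnj_complex_of_real eq_iff_diff_eq_0)
  have qc: "complex_of_real q = (z - of_real d) * (cnj z - of_real d)"
    unfolding q_def by (subst complex_norm_square) simp
  have "v *\<^sub>R (z - of_real d) = (of_real d ^ 2 - 1) / (cnj z - of_real d)"
    using ne ne' by (simp add: v_def scaleR_conv_of_real qc)
  then have w: "second_intersection d z = of_real d + v *\<^sub>R (z - of_real d)"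
    using ne' by (simp add: second_intersection_def field_simps power2_eq_square)
  have z2: "(Re z)\<^sup>2 + (Im z)\<^sup>2 = 1"
    using z by (metis cmod_power2 power_one)
  have qr: "q = 1 - 2 * d * Re z + d\<^sup>2"
    using z2 unfolding q_def cmod_power2 by (simp add: power2_eq_square algebra_simps)
  have nrm: "(norm (of_real d + u *\<^sub>R (z - of_real d)))\<^sup>2 - 1 = (u - 1) * q * (u - v)" for u
  proof -
    have "(norm (of_real d + u *\<^sub>R (z - of_real d)))\<^sup>2 - 1 
       = (d + u * (Re z - d))\<^sup>2 + u\<^sup>2 * (Im z)\<^sup>2 - 1"
      unfolding cmod_power2 by (simp add: power_mult_distrib)
    also have "\<dots> = (u - 1) * (u * q - (d\<^sup>2 - 1))"
    proof -
      have i: "(Im z)\<^sup>2 = 1 - (Re z)\<^sup>2" using z2 by simp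
      show ?thesis unfolding i qr by (simp add: power2_eq_square algebra_simps)
    qed
    also have "\<dots> = (u - 1) * q * (u - v)"
      using q by (simp add: v_def field_simps)
    finally show ?thesis .
  qed
  have on: "norm (of_real d + u *\<^sub>R (z - of_real d)) = 1 \<longleftrightarrow> u = 1 \<or> u = v" for u
  proof -
    have "norm (of_real d + u *\<^sub>R (z - of_real d)) = 1
      \<longleftrightarrow> (norm (of_real d + u *\<^sub>R (z - of_real d)))\<^sup>2 - 1 = 0"
      by (simp add: power2_eq_1_iff) (smt (verit) norm_ge_zero)
    also have "\<dots> \<longleftrightarrow> u = 1 \<or> u = v"
      unfolding nrm using q by auto
    finally show ?thesis .
  qed
  have one: "of_real d + (1::real) *\<^sub>R (z - of_real d) = z" by simp
  show "sphere 0 1 \<inter> affine hull {of_real d, z} = {z, second_intersection d z}"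
  proof (intro set_eqI iffI)
    fix x assume "x \<in> sphere 0 1 \<inter> affine hull {of_real d, z}"
    then obtain u where "x = of_real d + u *\<^sub>R (z - of_real d)" "norm x = 1"
      by (auto simp: affine_hull_2_alt)
    then show "x \<in> {z, second_intersection d z}"
      using on [of u] w one by auto
  next
    fix x assume "x \<in> {z, second_intersection d z}"
    then obtain u where "x = of_real d + u *\<^sub>R (z - of_real d)" "u = 1 \<or> u = v"
      using w one by (metis insertE singletonD)
    then show "x \<in> sphere 0 1 \<inter> affine hull {of_real d, z}"
      using on [of u] by (auto simp: affine_hull_2_alt)
  qed
  have "second_intersection d z - z = (v - 1) *\<^sub>R (z - of_real d)"
    unfolding w by (simp add: algebra_simps)
  then show "second_intersection d z \<noteq> z"
    using v ne by auto
qed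

end

theory Submission
  imports Defs
begin

text \<open>In the variable \<open>cnj z\<close> the map \<open>z \<mapsto> w\<close> is a Moebius transformation of determinant
  \<open>1 - d\<^sup>2\<close>, so \<open>\<bar>w - w'\<bar> = (1 - d\<^sup>2) \<bar>z - z'\<bar> / (\<bar>z - d\<bar> \<bar>z' - d\<bar>)\<close>. As consecutive base
  vertices are at distance \<open>2 sin \<alpha>\<close>, the inverse squared side is, up to a constant factor,
  \<open>\<bar>z - d\<bar>\<^sup>2 \<bar>z' - d\<bar>\<^sup>2\<close>. This is a trigonometric polynomial in the angle whose frequencies
  are 0, 1 and 2, and for \<open>N \<ge> 3\<close> the frequencies 1 and 2 sum to zero over the regular polygon.\<close>

lemma dist_second_intersection:
  assumes "\<bar>d\<bar> \<noteq> norm z" and "\<bar>d\<bar> \<noteq> norm z'"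
  shows "dist (second_intersection d z) (second_intersection d z')
    = \<bar>1 - d\<^sup>2\<bar> * dist z z' / (dist z (of_real d) * dist z' (of_real d))"
proof -
  have ne: "cnj x - of_real d \<noteq> 0" if "\<bar>d\<bar> \<noteq> norm x" for x
    using that by (metis complex_mod_cnj eq_iff_diff_eq_0 norm_of_real)
  have n: "norm (cnj x - of_real d) = dist x (of_real d)" for x
    unfolding dist_norm by (metis complex_cnj_complex_of_real complex_cnj_diff complex_mod_cnj)
  \<comment> \<open>With \<open>u = cnj z\<close> and \<open>u' = cnj z'\<close>, the numerator over
    the common denominator is \<open>(d*u - 1)*(u' - d) - (d*u' - 1)*(u - d)\<close>, which
    collapses to \<open>(1 - d^2)*(u - u')\<close>.\<close>
  have "second_intersection d z - second_intersection d z'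
      = of_real (1 - d\<^sup>2) * cnj (z - z') / ((cnj z - of_real d) * (cnj z' - of_real d))"
    using ne[OF assms(1)] ne[OF assms(2)]
    by (simp add: second_intersection_def divide_simps) (simp add: algebra_simps power2_eq_square)
  then show ?thesis
    by (simp only: dist_norm[of "second_intersection d z"] norm_divide norm_mult n
        norm_of_real complex_mod_cnj dist_norm[of z z'])
qed

lemma dist_cis_of_real_squared: "(dist (cis x) (of_real d))\<^sup>2 = 1 + d\<^sup>2 - 2 * d * cos x"
proof -
  have "(dist (cis x) (of_real d))\<^sup>2 = (sin x)\<^sup>2 + (cos x)\<^sup>2 + d\<^sup>2 - 2 * d * cos x"
    unfolding dist_norm cmod_power2 by (simp add: power2_eq_square algebra_simps)
  then show ?thesis by simp
qed

lemma dist_cis_squared: "(dist (cis x) (cis y))\<^sup>2 = 4 * (sin ((x - y) / 2))\<^sup>2"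
proof -
  have "(dist (cis x) (cis y))\<^sup>2 = ((sin x)\<^sup>2 + (cos x)\<^sup>2) + ((sin y)\<^sup>2 + (cos y)\<^sup>2) - 2 * cos (x - y)"
    unfolding dist_norm cmod_power2 cos_diff by (simp add: power2_eq_square algebra_simps)
  also have "\<dots> = 4 * (sin ((x - y) / 2))\<^sup>2"
    using cos_double_sin[of "(x - y) / 2"] by (simp del: right_diff_distrib_numeral) simp
  finally show ?thesis .
qed

text \<open>Multiplying by \<open>2 * sin (a / 2)\<close> makes each summand a difference of sines
  half a step to either side, so the sum telescopes. Keeping the factor on the left avoids dividing
  by a possible zero.\<close>

lemma sum_cos_arith_progression:
  "2 * sin (a / 2) * (\<Sum>k = 1..int n. cos (a * of_int k + b))
    = sin (a * real n + a / 2 + b) - sin (a / 2 + b)"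
proof (induction n)
  case 0
  show ?case by simp
next
  case (Suc n)
  have "{1..int (Suc n)} = insert (int (Suc n)) {1..int n}" by auto
  then have "2 * sin (a / 2) * (\<Sum>k = 1..int (Suc n). cos (a * of_int k + b))
      = 2 * sin (a / 2) * cos (a * real (Suc n) + b)
        + (sin (a * real n + a / 2 + b) - sin (a / 2 + b))"
    using Suc by (simp add: distrib_left)
  also have "2 * sin (a / 2) * cos (a * real (Suc n) + b)
      = sin (a * real (Suc n) + a / 2 + b) - sin (a * real n + a / 2 + b)"
  proof -
    have "2 * sin (a / 2) * cos c = sin (c + a / 2) - sin (c - a / 2)" for c
      by (simp add: sin_add sin_diff)
    moreover have "a * real (Suc n) + b - a / 2 = a * real n + a / 2 + b"
      by (simp add: field_simps)
    ultimately show ?thesis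
      by (simp add: add_ac)
  qed
  finally show ?case by simp
qed

text \<open>The bounds on \<open>m\<close> put the half step \<open>pi * m / N\<close> strictly
  between 0 and \<open>pi\<close>, so its sine can be cancelled; the two ends of the telescoped sum
  differ by \<open>m\<close> full turns.\<close>

lemma sum_cos_roots_of_unity:
  fixes m N :: nat
  assumes "0 < m" and "m < N"
  shows "(\<Sum>k = 1..int N. cos (2 * pi * real m / real N * of_int k + b)) = 0"
proof -
  let ?a = "2 * pi * real m / real N"
  have "sin (?a / 2) > 0"
    using assms by (intro sin_gt_zero) (simp_all add: field_simps)
  moreover have "sin (?a * real N + ?a / 2 + b) = sin (?a / 2 + b)"
  proof -
    have "?a * real N + ?a / 2 + b = (?a / 2 + b) + 2 * pi * real m"
      using assms by simp
    moreover have "sin (x + 2 * pi * real m) = sin x" for x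
      using sin_2npi[of m] cos_2npi[of m] by (simp add: sin_add mult_ac)
    ultimately show ?thesis by metis
  qed
  ultimately show ?thesis
    using sum_cos_arith_progression[of ?a b N] by simp
qed

text \<open>Product-to-sum linearises the product of the two squared distances to \<open>d\<close>.
  Each cosine that depends on \<open>k\<close> is kept in the form
  \<open>cos (c * of_int k + b)\<close>, ready for summation.\<close>

lemma inverse_harmonic_side_squared:
  fixes N :: nat and d t :: real and k :: int
  assumes "\<bar>d\<bar> < 1"
  defines "\<alpha> \<equiv> pi / real N"
  shows "1 / (harmonic_side N d t k)\<^sup>2
    = ((1 + d\<^sup>2)\<^sup>2 + 2 * d\<^sup>2 * cos (2 * \<alpha>)
       - 2 * d * (1 + d\<^sup>2) * (cos (2 * \<alpha> * of_int k + t) + cos (2 * \<alpha> * of_int k + (t - 2 * \<alpha>)))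
       + 2 * d\<^sup>2 * cos (4 * \<alpha> * of_int k + (2 * t - 2 * \<alpha>)))
      / (4 * (1 - d\<^sup>2)\<^sup>2 * (sin \<alpha>)\<^sup>2)"
proof -
  define x where "x = 2 * \<alpha> * of_int k + t"
  \<comment> \<open>The angle of base vertex \<open>k - 1\<close>, with the index shift moved into
    the phase.\<close>
  define y where "y = 2 * \<alpha> * of_int k + (t - 2 * \<alpha>)"
  have "harmonic_side N d t k
      = dist (second_intersection d (cis x)) (second_intersection d (cis y))"
    unfolding harmonic_side_def harmonic_vertex_def base_vertex_def x_def y_def \<alpha>_def
    by (simp add: algebra_simps diff_divide_distrib)
  then have "(harmonic_side N d t k)\<^sup>2 = (1 - d\<^sup>2)\<^sup>2 * (dist (cis x) (cis y))\<^sup>2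
      / ((dist (cis x) (of_real d))\<^sup>2 * (dist (cis y) (of_real d))\<^sup>2)"
    using assms(1) by (simp add: dist_second_intersection power_divide power_mult_distrib)
  moreover have "(x - y) / 2 = \<alpha>" by (simp add: x_def y_def)
  \<comment> \<open>If \<open>sin \<alpha> = 0\<close>, both sides are 0 by the convention for
    division by zero.\<close>
  ultimately have "1 / (harmonic_side N d t k)\<^sup>2
      = ((1 + d\<^sup>2 - 2 * d * cos x) * (1 + d\<^sup>2 - 2 * d * cos y)) / (4 * (1 - d\<^sup>2)\<^sup>2 * (sin \<alpha>)\<^sup>2)"
    unfolding dist_cis_of_real_squared dist_cis_squared by simp
  also have "(1 + d\<^sup>2 - 2 * d * cos x) * (1 + d\<^sup>2 - 2 * d * cos y)
      = (1 + d\<^sup>2)\<^sup>2 - 2 * d * (1 + d\<^sup>2) * (cos x + cos y) + 2 * d\<^sup>2 * (2 * (cos x * cos y))"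
    by (simp add: power2_eq_square algebra_simps)
  also have "2 * (cos x * cos y) = cos (2 * \<alpha>) + cos (4 * \<alpha> * of_int k + (2 * t - 2 * \<alpha>))"
    by (simp add: cos_times_cos x_def y_def algebra_simps)
  finally show ?thesis
    by (simp add: x_def y_def algebra_simps)
qed

theorem proposition1:
  fixes N :: nat and d \<alpha> :: real
  assumes "N \<ge> 3" and "\<alpha> = pi / real N" and "\<bar>d\<bar> < 1"
  shows "(\<forall>t t'. (\<Sum>k = 1..int N. 1 / (harmonic_side N d t k)\<^sup>2)
                 = (\<Sum>k = 1..int N. 1 / (harmonic_side N d t' k)\<^sup>2)) \<and>
         (\<forall>t. (\<Sum>k = 1..int N. 1 / (harmonic_side N d t k)\<^sup>2)
              = real N * ((d\<^sup>2 * (cos \<alpha>)\<^sup>2 + (d ^ 4 + 1) / 4) / ((1 - d\<^sup>2)\<^sup>2 * (sin \<alpha>)\<^sup>2)))"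
proof -
  have c1: "(\<Sum>k = 1..int N. cos (2 * \<alpha> * of_int k + b)) = 0" for b
    using sum_cos_roots_of_unity[of 1 N b] assms(1,2) by simp
  \<comment> \<open>Frequency 2 is where \<open>N \<ge> 3\<close> enters: \<open>m = 2\<close> must
    lie below \<open>N\<close>.\<close>
  have c2: "(\<Sum>k = 1..int N. cos (4 * \<alpha> * of_int k + b)) = 0" for b
    using sum_cos_roots_of_unity[of 2 N b] assms(1,2) by simp
  have "(\<Sum>k = 1..int N. 1 / (harmonic_side N d t k)\<^sup>2)
      = real N * ((d\<^sup>2 * (cos \<alpha>)\<^sup>2 + (d ^ 4 + 1) / 4) / ((1 - d\<^sup>2)\<^sup>2 * (sin \<alpha>)\<^sup>2))" for t
  proof -
    have "(\<Sum>k = 1..int N. 1 / (harmonic_side N d t k)\<^sup>2)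
        = real N * ((1 + d\<^sup>2)\<^sup>2 + 2 * d\<^sup>2 * cos (2 * \<alpha>)) / (4 * (1 - d\<^sup>2)\<^sup>2 * (sin \<alpha>)\<^sup>2)"
      unfolding inverse_harmonic_side_squared[OF assms(3)] assms(2)[symmetric]
      by (simp only: sum_divide_distrib[symmetric] sum.distrib sum_subtractf
          sum_distrib_left[symmetric] c1 c2) (simp add: distrib_left)
    \<comment> \<open>Writing \<open>cos (2 * \<alpha>)\<close> through the squared cosine produces
      \<open>-2 * d^2\<close>, which cancels the cross term of \<open>(1 + d^2)^2\<close>.\<close>
    also have "(1 + d\<^sup>2)\<^sup>2 + 2 * d\<^sup>2 * cos (2 * \<alpha>) = 4 * (d\<^sup>2 * (cos \<alpha>)\<^sup>2 + (d ^ 4 + 1) / 4)"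
      unfolding cos_double_cos by (simp add: power2_eq_square power4_eq_xxxx algebra_simps)
    finally show ?thesis by (simp only: times_divide_eq_right mult.left_commute[of _ 4] mult.assoc) simp
  qed
  then show ?thesis by simp
qed

end
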